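(* Let $n,p\ge 1$ be integers and $\lambda>0$. Let $\mathrm{Ob}(n,p)=\{X\in\mathbb{R}^{n\times p}: \operatorname{diag}(X^\top X)=1_p\}$ (matrices all of whose columns have Euclidean norm $1$) and $\mathrm{Ob}^+(n,p)=\mathrm{Ob}(n,p)\cap\{X\in\mathbb{R}^{n\times p}: X_{ij}\ge 0 \text{ for all } i,j\}$. For $V\in\mathbb{R}^{n\times p}$ with columns $V_1,\dots,V_p$ put $\|V\|_{2,\infty}=\max_{1\le i\le p}\|V_i\|_2$. Then the functions $h(X)=\lambda\|X\|_1+\delta_{\mathrm{Ob}(n,p)}(X)$ and $h(X)=\delta_{\mathrm{Ob}^+(n,p)}(X)$ on $\mathbb{R}^{n\times p}$ are strongly prox-regular and their proximal operators are semismooth. Specifically: (i) Let $\mathcal{C}_1=\mathrm{Ob}(n,p)$ and $\gamma_1=\frac{1}{(\lambda+1)n}$. The function $h(X)=\lambda\|X\|_1+\delta_{\mathrm{Ob}(n,p)}(X)$ is strongly prox-regular with respect to $\mathcal{C}_1$, $\|\cdot\|_{2,\infty}$ and $\gamma_1$. Moreover, for $t\in(0,\gamma_1]$ the proximal mapping $\mathrm{prox}_{th}$ is semismooth over the set $\mathcal{D}_1=\{X+sV: X\in\mathcal{C}_1,\ \|V\|_{2,\infty}=1,\ 0\le s\le\gamma_1\}$. (ii) Let $\mathcal{C}_2=\mathrm{Ob}^+(n,p)$ and $0<\gamma_2<1$. The function $h(X)=\delta_{\mathrm{Ob}^+(n,p)}(X)$ is strongly prox-regular with respect to $\mathcal{C}_2$,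 $\|\cdot\|$ and $\gamma_2$, where $\|\cdot\|$ is the Frobenius norm. Moreover, for $t\in(0,\gamma_2]$ the proximal mapping $\mathrm{prox}_{th}$ is semismooth over the set $\mathcal{D}_2=\{X+sV: X\in\mathcal{C}_2,\ \|V\|_{2,\infty}=1,\ 0\le s\le\gamma_2\}$.
   Context: $\|X\|_1=\sum_{i,j}|X_{ij}|$; $\delta_{\mathcal{S}}$ is the indicator function of a set $\mathcal{S}$ ($0$ on $\mathcal{S}$, $+\infty$ elsewhere). $\mathbb{R}^{n\times p}$ carries the Frobenius inner product. Proximal operator: for $t>0$, $\mathrm{prox}_{th}(x)=\operatorname{arg\,min}_u\{th(u)+\frac12\|x-u\|^2\}$ with $\|\cdot\|$ the Euclidean (here Frobenius) norm; a priori it is set-valued. Strong prox-regularity: a proper, closed, extended-real-valued function $h$ on a Euclidean space $E$ is strongly prox-regular with respect to a compact set $\mathcal{C}\supset\operatorname{dom}(h)$, a norm $N$ on $E$ and a constant $\gamma>0$ if, for every $t\in(0,\gamma]$, $\mathrm{prox}_{th}$ is single-valued, Lipschitz continuous and monotone (i.e. $\langle \mathrm{prox}_{th}(x)-\mathrm{prox}_{th}(y),x-y\rangle\ge 0$) over the set $\{x+sv: x\in\mathcal{C},\ N(v)=1,\ 0\le s\le\gamma\}$. $h$ is strongly prox-regular if this holds for some such $\mathcal{C},N,\gamma$. Semismoothness: a map $G$ that is single-valued and Lipschitz continuous near a point $x$ is semismooth at $x$ if $G$ is directionally differentiable at $x$ and, for all $d$ and $J\in\partial_C G(x+d)$, $\|G(x+d)-G(x)-Jd\|=o(\|d\|)$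 as $d\to0$. Here $\partial_C G(y)$ is the Clarke generalized Jacobian, i.e. the closed convex hull of $\partial_B G(y)=\{\lim_k G'(y^k): y^k\to y,\ G \text{ differentiable at } y^k\}$. Semismooth over a set means semismooth at every point of it. *)

theory Defs
  imports "HOL-Analysis.Analysis"
begin

definition ind_fun :: "'a set \<Rightarrow> 'a \<Rightarrow> ereal" where
  "ind_fun S x = (if x \<in> S then 0 else \<infinity>)"

definition dom_fun :: "('a \<Rightarrow> ereal) \<Rightarrow> 'a set" where
  "dom_fun h = {x. h x < \<infinity>}"

definition proper_fun :: "('a \<Rightarrow> ereal) \<Rightarrow> bool" where
  "proper_fun h \<longleftrightarrow> dom_fun h \<noteq> {} \<and> (\<forall>x. h x \<noteq> -\<infinity>)"

definition closed_fun :: "('a::topological_space \<Rightarrow> ereal) \<Rightarrow> bool" where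
  "closed_fun h \<longleftrightarrow> closed {(x, r::real). h x \<le> ereal r}"

text \<open>The proximal operator \<open>prox h t\<close> of \<open>t h\<close> is set-valued.\<close>

definition prox :: "('a::real_normed_vector \<Rightarrow> ereal) \<Rightarrow> real \<Rightarrow> 'a \<Rightarrow> 'a set" where
  "prox h t x =
     {u. is_arg_min (\<lambda>u. ereal t * h u + ereal (1/2 * (norm (x - u))\<^sup>2)) (\<lambda>u. True) u}"

definition single_valued_on :: "'a set \<Rightarrow> ('a \<Rightarrow> 'b set) \<Rightarrow> bool" where
  "single_valued_on S F \<longleftrightarrow> (\<forall>x\<in>S. \<exists>u. F x = {u})"

text \<open>The point map underlying a set-valued map; its values are unspecified where \<open>F\<close> is not
  single-valued.\<close>

definition selection :: "('a \<Rightarrow> 'b set) \<Rightarrow> 'a \<Rightarrow> 'b" where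
  "selection F x = the_elem (F x)"

definition monotone_map_on :: "'a::real_inner set \<Rightarrow> ('a \<Rightarrow> 'a) \<Rightarrow> bool" where
  "monotone_map_on S g \<longleftrightarrow> (\<forall>x\<in>S. \<forall>y\<in>S. inner (g x - g y) (x - y) \<ge> 0)"

definition norm_fun :: "('a::real_vector \<Rightarrow> real) \<Rightarrow> bool" where
  "norm_fun N \<longleftrightarrow> (\<forall>x. N x = 0 \<longleftrightarrow> x = 0) \<and> (\<forall>c x. N (c *\<^sub>R x) = \<bar>c\<bar> * N x)
     \<and> (\<forall>x y. N (x + y) \<le> N x + N y)"

definition tube :: "'a::real_vector set \<Rightarrow> ('a \<Rightarrow> real) \<Rightarrow> real \<Rightarrow> 'a set" where
  "tube C N \<gamma> = {x + s *\<^sub>R v | x s v. x \<in> C \<and> N v = 1 \<and> 0 \<le> s \<and> s \<le> \<gamma>}"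

definition strongly_prox_regular_wrt ::
  "('a::euclidean_space \<Rightarrow> ereal) \<Rightarrow> 'a set \<Rightarrow> ('a \<Rightarrow> real) \<Rightarrow> real \<Rightarrow> bool" where
  "strongly_prox_regular_wrt h C N \<gamma> \<longleftrightarrow>
     proper_fun h \<and> closed_fun h \<and> compact C \<and> dom_fun h \<subseteq> C \<and> norm_fun N \<and> \<gamma> > 0 \<and>
     (\<forall>t\<in>{0<..\<gamma>}.
        single_valued_on (tube C N \<gamma>) (prox h t) \<and>
        (\<exists>L. L-lipschitz_on (tube C N \<gamma>) (selection (prox h t))) \<and>
        monotone_map_on (tube C N \<gamma>) (selection (prox h t)))"

definition strongly_prox_regular :: "('a::euclidean_space \<Rightarrow> ereal) \<Rightarrow> bool" where
  "strongly_prox_regular h \<longleftrightarrow> (\<exists>C N \<gamma>. strongly_prox_regular_wrt h C N \<gamma>)"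

definition directionally_differentiable_at ::
  "('a::real_normed_vector \<Rightarrow> 'b::real_normed_vector) \<Rightarrow> 'a \<Rightarrow> bool" where
  "directionally_differentiable_at g x \<longleftrightarrow>
     (\<forall>d. \<exists>l. ((\<lambda>\<tau>. (g (x + \<tau> *\<^sub>R d) - g x) /\<^sub>R \<tau>) \<longlongrightarrow> l) (at_right 0))"

text \<open>Jacobians are represented as bounded linear maps.\<close>

definition bouligand_subdiff ::
  "('a::euclidean_space \<Rightarrow> 'b::euclidean_space) \<Rightarrow> 'a \<Rightarrow> ('a \<Rightarrow>\<^sub>L 'b) set" where
  "bouligand_subdiff g y =
     {J. \<exists>z D. z \<longlonglongrightarrow> y \<and> (\<forall>k::nat. (g has_derivative blinfun_apply (D k)) (at (z k))) \<and>
         D \<longlonglongrightarrow> J}"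

definition clarke_jacobian ::
  "('a::euclidean_space \<Rightarrow> 'b::euclidean_space) \<Rightarrow> 'a \<Rightarrow> ('a \<Rightarrow>\<^sub>L 'b) set" where
  "clarke_jacobian g y = closure (convex hull (bouligand_subdiff g y))"

text \<open>Being single-valued and Lipschitz near \<open>x\<close> is part of semismoothness. The remaining
  conditions are local at \<open>x\<close>, so they do not depend on the unspecified values of
  \<^const>\<open>selection\<close> away from \<open>x\<close>.\<close>

definition semismooth_at ::
  "('a::euclidean_space \<Rightarrow> 'b::euclidean_space set) \<Rightarrow> 'a \<Rightarrow> bool" where
  "semismooth_at F x \<longleftrightarrow>
     (\<exists>r>0. single_valued_on (ball x r) F \<and> (\<exists>L. L-lipschitz_on (ball x r) (selection F))) \<and>
     directionally_differentiable_at (selection F) x \<and>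
     (\<forall>\<epsilon>>0. \<exists>\<delta>>0. \<forall>d. norm d < \<delta> \<longrightarrow>
        (\<forall>J\<in>clarke_jacobian (selection F) (x + d).
           norm (selection F (x + d) - selection F x - blinfun_apply J d) \<le> \<epsilon> * norm d))"

definition semismooth_over ::
  "('a::euclidean_space \<Rightarrow> 'b::euclidean_space set) \<Rightarrow> 'a set \<Rightarrow> bool" where
  "semismooth_over F S \<longleftrightarrow> (\<forall>x\<in>S. semismooth_at F x)"

text \<open>The type \<open>real^'p^'n\<close> consists of the matrices with \<open>n\<close> rows and \<open>p\<close> columns; its
  \<^const>\<open>norm\<close> and \<^const>\<open>inner\<close> are the Frobenius norm and inner product.\<close>

definition Ob :: "(real^'p^'n) set" where
  "Ob = {X. \<forall>j. (transpose X ** X) $ j $ j = 1}"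

definition Ob_nonneg :: "(real^'p^'n) set" where
  "Ob_nonneg = Ob \<inter> {X. \<forall>i j. X $ i $ j \<ge> 0}"

definition l1_norm :: "real^'p^'n \<Rightarrow> real" where
  "l1_norm X = (\<Sum>i\<in>UNIV. \<Sum>j\<in>UNIV. \<bar>X $ i $ j\<bar>)"

definition norm_2_inf :: "real^'p^'n \<Rightarrow> real" where
  "norm_2_inf V = Max (range (\<lambda>j. norm (column j V)))"

definition l1_ob_fun :: "real \<Rightarrow> real^'p^'n \<Rightarrow> ereal" where
  "l1_ob_fun lam X = ereal (lam * l1_norm X) + ind_fun Ob X"

end

theory Submission
  imports Defs
begin

text \<open>Both proximal maps are \<open>Y \<mapsto> Y / norm\<close> (columnwise) after an entrywise piecewise linear map
  \<open>S\<close>: soft thresholding, respectively the positive part. Indeed, on \<^const>\<open>Ob\<close> the proximal problem is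
  to maximise \<open>inner X U - t * h U\<close>, which is at most \<open>inner (S X) U\<close> with equality at the normalised
  \<open>S X\<close>. The constants keep the columns of \<open>S X\<close> away from \<open>0\<close> on the tube, whence the Lipschitz
  bound; monotonicity holds for every proximal map.

  For semismoothness, \<open>S\<close> is affine on short segments that end at the base point \<open>x\<close>. At a
  differentiability point \<open>z\<close> near \<open>x\<close> this determines the derivative in the direction \<open>x - z\<close>, which
  is the only one that semismoothness involves, so the elements of the Jacobian need not be computed.
  The estimate then passes to limits and to the closed convex hull.\<close>

section \<open>Semismoothness of a C1 map composed with a locally conic map\<close>

text \<open>Says that near \<open>x\<close> the map is \<open>S x\<close> plus a positively
  homogeneous map of \<open>z - x\<close>, with no remainder. Stated on segments ending at
  \<open>x\<close>, it needs no formula for the homogeneous part.\<close>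

definition locally_conic_at ::
  "('a::real_normed_vector \<Rightarrow> 'b::real_vector) \<Rightarrow> 'a \<Rightarrow> bool" where
  "locally_conic_at S x \<longleftrightarrow>
     (\<forall>\<^sub>F z in nhds x. \<forall>\<tau>\<in>{0..1}. S (x + \<tau> *\<^sub>R (z - x)) = S x + \<tau> *\<^sub>R (S z - S x))"

text \<open>The derivative is taken at the moving point \<open>y\<close>, as semismoothness
  requires. On a small ball all derivatives lie within \<open>e / 2\<close> of \<open>F' y0\<close>,
  hence within \<open>e\<close> of each other, and the mean value inequality is applied to the
  linearisation at \<open>y\<close>, evaluated at \<open>y0\<close>.\<close>

lemma C1_estimate:
  fixes F :: "'a::real_normed_vector \<Rightarrow> 'b::real_normed_vector" and F' :: "'a \<Rightarrow> 'a \<Rightarrow>\<^sub>L 'b"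
  assumes "open U" "y0 \<in> U"
    and F': "\<And>y. y \<in> U \<Longrightarrow> (F has_derivative blinfun_apply (F' y)) (at y)"
    and cont: "isCont F' y0" and "e > 0"
  shows "\<forall>\<^sub>F y in nhds y0. norm (F y - F y0 - F' y (y - y0)) \<le> e * norm (y - y0)"
proof -
  have "(F' \<longlongrightarrow> F' y0) (nhds y0)"
    using cont by (simp add: isCont_def tendsto_at_iff_tendsto_nhds)
  then have "\<forall>\<^sub>F y in nhds y0. dist (F' y) (F' y0) < e / 2"
    using \<open>e > 0\<close> by (intro tendstoD) auto
  moreover have "\<forall>\<^sub>F y in nhds y0. y \<in> U"
    using assms by (auto intro: eventually_nhds_in_open)
  ultimately have "\<forall>\<^sub>F y in nhds y0. dist (F' y) (F' y0) < e / 2 \<and> y \<in> U"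
    by (rule eventually_conj)
  then obtain \<delta> where \<delta>: "\<delta> > 0" "\<And>y. dist y y0 < \<delta> \<Longrightarrow> dist (F' y) (F' y0) < e / 2 \<and> y \<in> U"
    by (auto simp: eventually_nhds_metric)
  have "norm (F y - F y0 - F' y (y - y0)) \<le> e * norm (y - y0)" if y: "dist y y0 < \<delta>" for y
  proof -
    have "norm (F y0 - F y - F' y (y0 - y)) \<le> norm (y0 - y) * e"
    proof (rule differentiable_bound_linearization[where S = "ball y0 \<delta>"
          and f' = "\<lambda>y. blinfun_apply (F' y)"])
      show "y + t *\<^sub>R (y0 - y) \<in> ball y0 \<delta>" if "t \<in> {0..1}" for t
        using convexD_alt[OF convex_ball, of y y0 \<delta> y0 t] that y \<delta>(1)
        by (auto simp: dist_commute algebra_simps)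
      show "(F has_derivative blinfun_apply (F' z)) (at z within ball y0 \<delta>)"
        if "z \<in> ball y0 \<delta>" for z
        using \<delta>(2)[of z] that F' by (auto simp: dist_commute intro: has_derivative_at_withinI)
      show "onorm (blinfun_apply (F' z) - blinfun_apply (F' y)) \<le> e" if "z \<in> ball y0 \<delta>" for z
      proof -
        have "dist (F' z) (F' y) < e"
          using \<delta>(2)[of z] \<delta>(2)[OF y] that
            dist_triangle2[of "F' z" "F' y" "F' y0"]
          by (auto simp: dist_commute)
        moreover have "onorm (blinfun_apply (F' z) - blinfun_apply (F' y)) = dist (F' z) (F' y)"
          by (simp add: dist_norm norm_blinfun.rep_eq minus_blinfun.rep_eq fun_diff_def)
        ultimately show ?thesis by simp
      qed
      show "y \<in> ball y0 \<delta>" using y by (simp add: dist_commute)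
    qed
    moreover have "F y0 - F y - F' y (y0 - y) = - (F y - F y0 - F' y (y - y0))"
      by (simp add: blinfun.bilinear_simps)
    ultimately show ?thesis by (metis norm_minus_cancel norm_minus_commute mult.commute)
  qed
  then show ?thesis using \<delta>(1) by (auto simp: eventually_nhds_metric)
qed

lemma has_derivative_imp_directional:
  fixes F :: "'a::real_normed_vector \<Rightarrow> 'b::real_normed_vector"
  assumes "(F has_derivative D) (at y)"
  shows "((\<lambda>\<tau>. (F (y + \<tau> *\<^sub>R w) - F y) /\<^sub>R \<tau>) \<longlongrightarrow> D w) (at_right 0)"
proof -
  have D: "(F has_derivative D) (at (y + 0 *\<^sub>R w))" using assms by simp
  have "((\<lambda>\<tau>::real. y + \<tau> *\<^sub>R w) has_derivative (\<lambda>\<tau>. \<tau> *\<^sub>R w)) (at 0)"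
    by (auto intro!: derivative_eq_intros)
  from has_derivative_compose[OF this D]
  have "((\<lambda>\<tau>. F (y + \<tau> *\<^sub>R w)) has_derivative (\<lambda>\<tau>. D (\<tau> *\<^sub>R w))) (at (0::real))" .
  moreover have "D (\<tau> *\<^sub>R w) = \<tau> *\<^sub>R D w" for \<tau>
    using has_derivative_linear[OF assms] by (rule linear_scale)
  ultimately have "((\<lambda>\<tau>. F (y + \<tau> *\<^sub>R w)) has_vector_derivative D w) (at 0)"
    by (simp add: has_vector_derivative_def)
  then have "((\<lambda>\<tau>. F (y + \<tau> *\<^sub>R w)) has_vector_derivative D w) (at_right 0)"
    by (rule has_vector_derivative_at_within)
  then have "((\<lambda>\<tau>. (1 / norm (\<tau> - 0)) *\<^sub>R (F (y + \<tau> *\<^sub>R w) - (F (y + 0 *\<^sub>R w) + (\<tau> - 0) *\<^sub>R D w)))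
      \<longlongrightarrow> 0) (at_right 0)"
    unfolding has_vector_derivative_def has_derivative_within by blast
  then have "((\<lambda>\<tau>. (F (y + \<tau> *\<^sub>R w) - F y) /\<^sub>R \<tau> - D w) \<longlongrightarrow> 0) (at_right 0)"
    by (rule Lim_transform_eventually)
      (auto intro!: eventually_at_rightI[of 0 1] simp: algebra_simps divide_inverse)
  then show ?thesis by (rule LIM_zero_cancel)
qed

text \<open>Differentiability is used for the composite at \<open>z\<close> and for \<open>F\<close>
  at \<open>S z\<close>, never for \<open>S\<close>, so \<open>z\<close> may lie on a kink of
  \<open>S\<close>. Once the derivative along \<open>x - z\<close> is identified as
  \<open>F' (S z) (S x - S z)\<close>, \<open>C1_estimate\<close> at \<open>S x\<close> gives the
  bound.\<close>

lemma semismooth_at_compose_conic: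
  fixes S :: "'a::euclidean_space \<Rightarrow> 'c::real_normed_vector" and F :: "'c \<Rightarrow> 'b::euclidean_space"
    and F' :: "'c \<Rightarrow> 'c \<Rightarrow>\<^sub>L 'b"
  assumes "r > 0" and A: "\<And>z. z \<in> ball x r \<Longrightarrow> A z = {F (S z)}"
    and lip: "L-lipschitz_on (ball x r) (F \<circ> S)"
    and S: "K-lipschitz_on UNIV S" and conic: "locally_conic_at S x"
    and "open U" "S x \<in> U"
    and F': "\<And>y. y \<in> U \<Longrightarrow> (F has_derivative blinfun_apply (F' y)) (at y)"
    and cont: "isCont F' (S x)"
  shows "semismooth_at A x"
proof -
  let ?g = "selection A"
  define affine where "affine z \<longleftrightarrow>
    (\<forall>\<tau>\<in>{0..1}. S (x + \<tau> *\<^sub>R (z - x)) = S x + \<tau> *\<^sub>R (S z - S x))" for z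
  have conic: "\<forall>\<^sub>F z in nhds x. affine z"
    using conic by (simp add: locally_conic_at_def affine_def)
  have sel: "?g z = F (S z)" if "z \<in> ball x r" for z
    using A[OF that] by (simp add: selection_def)
  have lipsel: "L-lipschitz_on (ball x r) ?g"
    by (rule lipschitz_on_transform[OF lip]) (simp add: sel)
  have nb: "\<forall>\<^sub>F z in nhds x. z \<in> ball x r"
    using \<open>r > 0\<close> by (intro eventually_nhds_in_open) auto
  have dir: "\<exists>l. ((\<lambda>\<tau>. (?g (x + \<tau> *\<^sub>R d) - ?g x) /\<^sub>R \<tau>) \<longlongrightarrow> l) (at_right 0)" for d
  proof -
    have lim: "((\<lambda>\<tau>::real. x + \<tau> *\<^sub>R d) \<longlongrightarrow> x) (at_right 0)"
      by (auto intro!: tendsto_eq_intros)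
    have "\<forall>\<^sub>F \<tau>::real in at_right 0. \<tau> > 0 \<and> affine (x + \<tau> *\<^sub>R d)"
      using eventually_at_right_less eventually_compose_filterlim[OF conic lim]
      by (rule eventually_conj)
    then obtain \<tau>0 where \<tau>0: "\<tau>0 > 0" and con: "affine (x + \<tau>0 *\<^sub>R d)"
      using eventually_happens'[OF trivial_limit_at_right_real] by blast
    \<comment> \<open>The directional derivative of \<open>S\<close> at \<open>x\<close> along
      \<open>d\<close>: by conicity the difference quotient is constant up to \<tau>0, so one sample
      point determines it.\<close>
    define w where "w = (S (x + \<tau>0 *\<^sub>R d) - S x) /\<^sub>R \<tau>0"
    have Sw: "S (x + \<tau> *\<^sub>R d) = S x + \<tau> *\<^sub>R w" if "0 < \<tau>" "\<tau> < \<tau>0" for \<tau>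
    proof -
      have "\<tau> / \<tau>0 \<in> {0..1}" "\<tau> / \<tau>0 * \<tau>0 = \<tau>" using that by auto
      then show ?thesis
        using con unfolding affine_def w_def by (metis add_diff_cancel_left' divide_inverse scaleR_scaleR)
    qed
    have "((\<lambda>\<tau>. (F (S x + \<tau> *\<^sub>R w) - F (S x)) /\<^sub>R \<tau>) \<longlongrightarrow> F' (S x) w) (at_right 0)"
      using F' \<open>S x \<in> U\<close> by (intro has_derivative_imp_directional) auto
    moreover have "\<forall>\<^sub>F \<tau> in at_right 0. (F (S x + \<tau> *\<^sub>R w) - F (S x)) /\<^sub>R \<tau>
        = (?g (x + \<tau> *\<^sub>R d) - ?g x) /\<^sub>R \<tau>"
      using eventually_compose_filterlim[OF nb lim] eventually_at_right_real[OF \<tau>0]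
      by eventually_elim (use \<open>r > 0\<close> in \<open>simp add: sel Sw\<close>)
    ultimately show ?thesis by (intro exI) (rule Lim_transform_eventually)
  qed
  have est: "\<exists>\<delta>>0. \<forall>d. norm d < \<delta> \<longrightarrow> (\<forall>J\<in>clarke_jacobian ?g (x + d).
      norm (?g (x + d) - ?g x - J d) \<le> \<epsilon> * norm d)" if "\<epsilon> > 0" for \<epsilon>
  proof -
    have K: "K \<ge> 0" using S by (rule lipschitz_on_nonneg)
    have Slim: "(S \<longlongrightarrow> S x) (nhds x)"
      using lipschitz_on_continuous_on[OF S]
      by (simp add: continuous_on_eq_continuous_at isCont_def tendsto_at_iff_tendsto_nhds)
    \<comment> \<open>Dividing by \<open>K + 1\<close> absorbs the Lipschitz constant of
      \<open>S\<close>, which may be 0.\<close>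
    have e': "\<epsilon> / (K + 1) > 0" using K that by simp
    have "\<forall>\<^sub>F y in nhds (S x).
        norm (F y - F (S x) - F' y (y - S x)) \<le> \<epsilon> / (K + 1) * norm (y - S x)"
      using \<open>open U\<close> \<open>S x \<in> U\<close> F' cont e' by (rule C1_estimate)
    note 1 = eventually_compose_filterlim[OF this Slim]
    have "\<forall>\<^sub>F y in nhds (S x). y \<in> U"
      using \<open>open U\<close> \<open>S x \<in> U\<close> by (rule eventually_nhds_in_open)
    note 2 = eventually_compose_filterlim[OF this Slim]
    have "\<forall>\<^sub>F z in nhds x. z \<in> ball x r \<and> S z \<in> U \<and> affine z \<and>
        norm (F (S z) - F (S x) - F' (S z) (S z - S x)) \<le> \<epsilon> / (K + 1) * norm (S z - S x)"
      using 1 2 nb conic by eventually_elim simp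
    then obtain \<delta> where "\<delta> > 0" and \<delta>: "\<And>z. dist z x < \<delta> \<Longrightarrow> z \<in> ball x r \<and> S z \<in> U \<and> affine z \<and>
        norm (F (S z) - F (S x) - F' (S z) (S z - S x)) \<le> \<epsilon> / (K + 1) * norm (S z - S x)"
      unfolding eventually_nhds_metric by blast
    have diff: "norm (?g z - ?g x - D (z - x)) \<le> \<epsilon> * norm (z - x)"
      if z: "dist z x < \<delta>" and D: "(?g has_derivative blinfun_apply D) (at z)" for z D
    proof -
      have zr: "z \<in> ball x r" using \<delta>[OF z] by simp
      \<comment> \<open>The same quotients are computed in two ways, through the assumed derivative
        \<open>D\<close> of the composite and through \<open>F'\<close>; uniqueness of limits then
        identifies \<open>D (x - z)\<close>.\<close>
      have lim1: "((\<lambda>\<tau>. (?g (z + \<tau> *\<^sub>R (x - z)) - ?g z) /\<^sub>R \<tau>) \<longlongrightarrow> D (x - z)) (at_right 0)"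
        using D by (rule has_derivative_imp_directional)
      have lim2: "((\<lambda>\<tau>. (F (S z + \<tau> *\<^sub>R (S x - S z)) - F (S z)) /\<^sub>R \<tau>)
          \<longlongrightarrow> F' (S z) (S x - S z)) (at_right 0)"
        using \<delta>[OF z] F' by (intro has_derivative_imp_directional) auto
      have ev: "\<forall>\<^sub>F \<tau> in at_right 0. (F (S z + \<tau> *\<^sub>R (S x - S z)) - F (S z)) /\<^sub>R \<tau>
          = (?g (z + \<tau> *\<^sub>R (x - z)) - ?g z) /\<^sub>R \<tau>"
      proof (rule eventually_at_rightI[of 0 1])
        fix \<tau> :: real assume \<tau>: "\<tau> \<in> {0<..<1}"
        \<comment> \<open>Conicity is based at \<open>x\<close> while the derivative is taken at
          \<open>z\<close>, so the segment is traversed backwards, with parameter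
          \<open>1 - \<tau>\<close>.\<close>
        have eq: "z + \<tau> *\<^sub>R (x - z) = x + (1 - \<tau>) *\<^sub>R (z - x)" by (simp add: algebra_simps)
        have "z + \<tau> *\<^sub>R (x - z) \<in> ball x r"
          using convexD_alt[OF convex_ball zr, of x \<tau>] \<tau> \<open>r > 0\<close> by (auto simp: algebra_simps)
        moreover have "S (z + \<tau> *\<^sub>R (x - z)) = S x + (1 - \<tau>) *\<^sub>R (S z - S x)"
          unfolding eq using \<delta>[OF z] \<tau> by (simp add: affine_def)
        moreover have "S x + (1 - \<tau>) *\<^sub>R (S z - S x) = S z + \<tau> *\<^sub>R (S x - S z)"
          by (simp add: algebra_simps)
        ultimately show "(F (S z + \<tau> *\<^sub>R (S x - S z)) - F (S z)) /\<^sub>R \<tau>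
            = (?g (z + \<tau> *\<^sub>R (x - z)) - ?g z) /\<^sub>R \<tau>"
          using zr by (simp add: sel)
      qed simp
      have "D (x - z) = F' (S z) (S x - S z)"
        by (rule tendsto_unique[OF trivial_limit_at_right_real lim1
              Lim_transform_eventually[OF lim2 ev]])
      then have "D (z - x) = F' (S z) (S z - S x)"
        by (simp add: blinfun.bilinear_simps algebra_simps)
      then have "norm (?g z - ?g x - D (z - x)) \<le> \<epsilon> / (K + 1) * norm (S z - S x)"
        using \<delta>[OF z] sel[OF zr] sel[of x] \<open>r > 0\<close> by simp
      moreover have "norm (S z - S x) \<le> (K + 1) * norm (z - x)"
      proof -
        have "norm (S z - S x) \<le> K * norm (z - x)"
          using lipschitz_onD[OF S, of z x] by (simp add: dist_norm)
        also have "\<dots> \<le> (K + 1) * norm (z - x)" by (intro mult_right_mono) auto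
        finally show ?thesis .
      qed
      then have "\<epsilon> / (K + 1) * norm (S z - S x) \<le> \<epsilon> / (K + 1) * ((K + 1) * norm (z - x))"
        using e' by (intro mult_left_mono) auto
      moreover have "\<epsilon> / (K + 1) * ((K + 1) * norm (z - x)) = \<epsilon> * norm (z - x)"
        using K by simp
      ultimately show ?thesis by linarith
    qed
    have "norm (?g (x + d) - ?g x - J d) \<le> \<epsilon> * norm d"
      if d: "norm d < \<delta>" and J: "J \<in> clarke_jacobian ?g (x + d)" for d J
    proof -
      \<comment> \<open>The Jacobians satisfying the estimate form the preimage of a closed ball
        under the linear evaluation at \<open>d\<close>. This set is closed and convex, so it
        contains the Clarke Jacobian as soon as it contains the Bouligand limits.\<close>
      define B where "B = {J. norm (?g (x + d) - ?g x - blinfun_apply J d) \<le> \<epsilon> * norm d}"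
      have xd: "x + d \<in> ball x r" using \<delta>[of "x + d"] d by (simp add: dist_norm)
      have "bouligand_subdiff ?g (x + d) \<subseteq> B"
      proof
        fix J assume "J \<in> bouligand_subdiff ?g (x + d)"
        then obtain z D where zD: "z \<longlonglongrightarrow> x + d" "D \<longlonglongrightarrow> J"
            "\<And>k::nat. (?g has_derivative blinfun_apply (D k)) (at (z k))"
          by (auto simp: bouligand_subdiff_def)
        have "isCont ?g (x + d)"
          using lipschitz_on_continuous_on[OF lipsel] xd
          by (simp add: continuous_on_eq_continuous_at)
        then have "(\<lambda>k. ?g (z k)) \<longlonglongrightarrow> ?g (x + d)" using zD(1) by (rule isCont_tendsto_compose)
        then have "(\<lambda>k. norm (?g (z k) - ?g x - D k (z k - x)))
            \<longlonglongrightarrow> norm (?g (x + d) - ?g x - J (x + d - x))"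
          using zD by (intro tendsto_intros)
        moreover have "(\<lambda>k. \<epsilon> * norm (z k - x)) \<longlonglongrightarrow> \<epsilon> * norm (x + d - x)"
          using zD by (intro tendsto_intros)
        moreover have "\<forall>\<^sub>F k in sequentially. z k \<in> ball x \<delta>"
          using d by (intro topological_tendstoD[OF zD(1)]) (auto simp: dist_norm)
        then have "\<forall>\<^sub>F k in sequentially.
            norm (?g (z k) - ?g x - D k (z k - x)) \<le> \<epsilon> * norm (z k - x)"
          by eventually_elim (rule diff[OF _ zD(3)], simp add: dist_commute)
        ultimately have "norm (?g (x + d) - ?g x - J (x + d - x)) \<le> \<epsilon> * norm (x + d - x)"
          by (intro tendsto_le[OF sequentially_bot])
        then show "J \<in> B" by (simp add: B_def)
      qed
      moreover have B: "B = (\<lambda>J. blinfun_apply J d) -` cball (?g (x + d) - ?g x) (\<epsilon> * norm d)"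
        by (auto simp: B_def dist_norm)
      have "convex B" unfolding B
        by (intro convex_linear_vimage convex_cball bounded_linear.linear
            blinfun.bounded_linear_left)
      moreover have "closed B" unfolding B
        by (intro closed_vimage closed_cball continuous_intros)
      ultimately have "clarke_jacobian ?g (x + d) \<subseteq> B"
        unfolding clarke_jacobian_def by (intro closure_minimal hull_minimal)
      then show ?thesis using J by (auto simp: B_def)
    qed
    then show ?thesis using \<open>\<delta> > 0\<close> by blast
  qed
  show ?thesis
    unfolding semismooth_at_def single_valued_on_def directionally_differentiable_at_def
    using \<open>r > 0\<close> A lipsel dir est by blast
qed

section \<open>Columnwise normalisation and the set of matrices with unit columns\<close>

text \<open>The nearest-point projection onto \<open>Ob\<close> where no column vanishes. Since
  \<open>sgn 0 = 0\<close>, a zero column stays zero and the value is then outside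
  \<open>Ob\<close>.\<close>

definition normalize_columns :: "real^'p^'n \<Rightarrow> real^'p^'n" where
  "normalize_columns Y = (\<chi> i j. sgn (column j Y) $ i)"

lemma column_normalize_columns [simp]: "column j (normalize_columns Y) = sgn (column j Y)"
  by (simp add: normalize_columns_def column_def vec_eq_iff)

lemma bounded_linear_column: "bounded_linear (column j :: real^'p^'n \<Rightarrow> real^'n)"
  unfolding linear_conv_bounded_linear[symmetric]
  by (rule linearI) (simp_all add: column_def vec_eq_iff)

lemmas column_simps = linear_add[OF bounded_linear.linear[OF bounded_linear_column]]
  linear_diff[OF bounded_linear.linear[OF bounded_linear_column]]
  linear_scale[OF bounded_linear.linear[OF bounded_linear_column]]

lemma matrix_eq_iff_columns: "X = Y \<longleftrightarrow> (\<forall>j. column j X = column j Y)"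
  by (auto simp: column_def vec_eq_iff)

lemma inner_eq_sum_columns:
  fixes X Y :: "real^'p^'n"
  shows "inner X Y = (\<Sum>j\<in>UNIV. inner (column j X) (column j Y))"
  unfolding inner_vec_def by (subst sum.swap) (simp add: column_def)

lemma norm_sq_eq_sum_columns:
  fixes X :: "real^'p^'n"
  shows "(norm X)\<^sup>2 = (\<Sum>j\<in>UNIV. (norm (column j X))\<^sup>2)"
  by (simp add: power2_norm_eq_inner inner_eq_sum_columns)

lemma norm_column_le: "norm (column j X) \<le> norm (X :: real^'p^'n)"
proof -
  have "(norm (column j X))\<^sup>2 \<le> (norm X)\<^sup>2"
    unfolding norm_sq_eq_sum_columns by (rule member_le_sum) auto
  then show ?thesis by simp
qed

lemma norm_le_columnwise:
  fixes X Y :: "real^'p^'n"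
  assumes "\<And>j. norm (column j X) \<le> norm (column j Y)"
  shows "norm X \<le> norm Y"
proof -
  have "(norm X)\<^sup>2 \<le> (norm Y)\<^sup>2"
    unfolding norm_sq_eq_sum_columns by (intro sum_mono power_mono) (auto simp: assms)
  then show ?thesis by simp
qed

lemma Ob_iff: "X \<in> Ob \<longleftrightarrow> (\<forall>j. norm (column j X) = 1)"
proof -
  have "(transpose X ** X) $ j $ j = (norm (column j X))\<^sup>2" for j
    by (simp add: power2_norm_eq_inner inner_vec_def matrix_matrix_mult_def transpose_def column_def)
  then show ?thesis by (auto simp: Ob_def abs_square_eq_1)
qed

lemma normalize_columns_in_Ob: "(\<And>j. column j Y \<noteq> 0) \<Longrightarrow> normalize_columns Y \<in> Ob"
  by (simp add: Ob_iff norm_sgn)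

text \<open>Inserting \<open>b /\<^sub>R norm a\<close> splits the difference into a change of
  vector and a change of scale. Each part costs at most \<open>norm (a - b) / norm a\<close>, the
  second by the reverse triangle inequality; hence the factor 2.\<close>

lemma sgn_lipschitz:
  fixes a b :: "'a::real_normed_vector"
  assumes "c > 0" "c \<le> norm a" "c \<le> norm b"
  shows "norm (sgn a - sgn b) \<le> 2 / c * norm (a - b)"
proof -
  have na: "norm a > 0" and nb: "norm b > 0" using assms by auto
  have "sgn a - sgn b = (a - b) /\<^sub>R norm a + (inverse (norm a) - inverse (norm b)) *\<^sub>R b"
    by (simp add: sgn_div_norm algebra_simps)
  also have "norm \<dots> \<le> norm (a - b) / norm a + \<bar>inverse (norm a) - inverse (norm b)\<bar> * norm b"
    by (rule order_trans[OF norm_triangle_ineq]) (simp add: divide_inverse mult.commute)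
  also have "\<bar>inverse (norm a) - inverse (norm b)\<bar> * norm b = \<bar>norm b - norm a\<bar> / norm a"
  proof -
    have "inverse (norm a) - inverse (norm b) = (norm b - norm a) / (norm a * norm b)"
      using na nb by (simp add: field_simps)
    then show ?thesis using na nb by (simp add: abs_mult)
  qed
  also have "\<bar>norm b - norm a\<bar> \<le> norm (a - b)"
    by (metis norm_minus_commute norm_triangle_ineq3)
  also have "norm (a - b) / norm a + norm (a - b) / norm a = 2 * norm (a - b) / norm a" by simp
  also have "\<dots> \<le> 2 * norm (a - b) / c"
    using assms by (intro divide_left_mono mult_nonneg_nonneg mult_pos_pos) auto
  finally show ?thesis using na by (simp add: divide_right_mono)
qed

lemma normalize_columns_lipschitz:
  assumes "c > 0"
  shows "(2 / c)-lipschitz_on {Y. \<forall>j. c \<le> norm (column j Y)}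
           (normalize_columns :: real^'p^'n \<Rightarrow> real^'p^'n)"
proof (rule lipschitz_onI)
  fix X Y :: "real^'p^'n"
  assume X: "X \<in> {Y. \<forall>j. c \<le> norm (column j Y)}" and Y: "Y \<in> {Y. \<forall>j. c \<le> norm (column j Y)}"
  have "norm (normalize_columns X - normalize_columns Y) \<le> norm ((2 / c) *\<^sub>R (X - Y))"
  proof (rule norm_le_columnwise)
    fix j
    show "norm (column j (normalize_columns X - normalize_columns Y))
        \<le> norm (column j ((2 / c) *\<^sub>R (X - Y)))"
      using sgn_lipschitz[OF assms, of "column j X" "column j Y"] X Y assms
      by (simp add: column_simps)
  qed
  then show "dist (normalize_columns X) (normalize_columns Y) \<le> 2 / c * dist X Y"
    using assms by (simp add: dist_norm)
qed (use assms in simp)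

lemma normalize_columns_C1:
  fixes U :: "(real^'p^'n) set"
  defines "U \<equiv> {Y. \<forall>j. column j Y \<noteq> 0}"
  obtains F' :: "real^'p^'n \<Rightarrow> (real^'p^'n) \<Rightarrow>\<^sub>L (real^'p^'n)"
  where "open U"
    and "\<And>Y. Y \<in> U \<Longrightarrow> (normalize_columns has_derivative blinfun_apply (F' Y)) (at Y)"
    and "\<And>Y. Y \<in> U \<Longrightarrow> isCont F' Y"
proof -
  \<comment> \<open>The quotient rule for \<open>Y $ i $ j / norm (column j Y)\<close>, the
    derivative of the norm being the inner product with \<open>sgn\<close>.\<close>
  define D where "D Y V = (\<chi> i j. (V $ i $ j * norm (column j Y)
      - Y $ i $ j * inner (column j V) (sgn (column j Y))) / (norm (column j Y) * norm (column j Y)))"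
    for Y V :: "real^'p^'n"
  have cont_col: "continuous_on A (column j)" for A :: "(real^'p^'n) set" and j
    by (rule bounded_linear.continuous_on[OF bounded_linear_column continuous_on_id])
  have "U = (\<Inter>j. {Y. column j Y \<noteq> 0})" by (auto simp: U_def)
  then have "open U"
    by (auto intro!: open_INT open_Collect_neq cont_col continuous_intros)
  have D: "(normalize_columns has_derivative D Y) (at Y)" if Y: "Y \<in> U" for Y
  proof -
    have "((\<lambda>Y. normalize_columns Y $ i $ j) has_derivative (\<lambda>V. D Y V $ i $ j)) (at Y)" for i j
    proof -
      have nz: "column j Y \<noteq> 0" using Y by (simp add: U_def)
      have c: "(column j has_derivative column j) (at Y)"
        by (rule bounded_linear_imp_has_derivative[OF bounded_linear_column])
      have n: "((\<lambda>Y. norm (column j Y)) has_derivative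
          (\<lambda>V. inner (column j V) (sgn (column j Y)))) (at Y)"
        using has_derivative_compose[OF c has_derivative_norm[OF nz]] by simp
      have e: "((\<lambda>Y. Y $ i $ j) has_derivative (\<lambda>V. V $ i $ j)) (at Y)"
        by (intro bounded_linear_imp_has_derivative bounded_linear_compose[OF bounded_linear_vec_nth]
            bounded_linear_vec_nth)
      have "((\<lambda>Y. Y $ i $ j / norm (column j Y)) has_derivative (\<lambda>V. D Y V $ i $ j)) (at Y)"
        using has_derivative_divide'[OF e n] nz by (simp add: D_def)
      moreover have "(\<lambda>Y. Y $ i $ j / norm (column j Y)) = (\<lambda>Y. normalize_columns Y $ i $ j)"
        by (simp add: normalize_columns_def sgn_div_norm column_def divide_inverse mult.commute)
      ultimately show ?thesis by simp
    qed
    then show ?thesis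
      by (subst has_derivative_componentwise_within)
        (auto simp: Basis_vec_def inner_axis)
  qed
  \<comment> \<open>Off \<open>U\<close> the value of \<open>Blinfun\<close> is unspecified; since
    \<open>U\<close> is open, continuity at its points is not affected.\<close>
  define F' where "F' Y = Blinfun (D Y)" for Y
  have F': "blinfun_apply (F' Y) = D Y" if "Y \<in> U" for Y
    unfolding F'_def using has_derivative_bounded_linear[OF D[OF that]]
    by (rule bounded_linear_Blinfun_apply)
  have "isCont F' Y" if Y: "Y \<in> U" for Y
    unfolding isCont_def
  \<comment> \<open>In finite dimension, operator norm convergence can be tested on one vector
    \<open>V\<close> at a time.\<close>
  proof (rule tendsto_componentwise1)
    fix V :: "real^'p^'n"
    have nz: "column j Y \<noteq> 0" for j using Y by (simp add: U_def)
    have c: "((\<lambda>Y. column j Y) \<longlongrightarrow> column j Y) (at Y)" for j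
      by (rule bounded_linear.tendsto[OF bounded_linear_column tendsto_ident_at])
    have "((\<lambda>Y. D Y V) \<longlongrightarrow> D Y V) (at Y)"
      unfolding D_def using nz by (intro tendsto_intros c) auto
    moreover have "\<forall>\<^sub>F Z in at Y. D Z V = F' Z V"
      using eventually_at_in_open'[OF \<open>open U\<close> Y] by eventually_elim (simp add: F')
    ultimately show "((\<lambda>Z. F' Z V) \<longlongrightarrow> F' Y V) (at Y)"
      using F'[OF Y] by (auto intro: Lim_transform_eventually)
  qed
  then show ?thesis using that[of F'] \<open>open U\<close> D F' by simp
qed

section \<open>Entrywise maps followed by normalisation\<close>

lemma map_matrix_lipschitz:
  fixes P :: "real \<Rightarrow> real"
  assumes "1-lipschitz_on UNIV P"
  shows "1-lipschitz_on UNIV (map_matrix P :: real^'p^'n \<Rightarrow> real^'p^'n)"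
  using lipschitz_onD[OF assms]
  by (auto intro!: lipschitz_onI norm_le_componentwise_cart simp: dist_norm)

text \<open>There are finitely many entries, so the neighbourhoods belonging to them have a common
  one.\<close>

lemma locally_conic_at_map_matrix:
  fixes P :: "real \<Rightarrow> real" and X :: "real^'p^'n"
  assumes "\<And>x. locally_conic_at P x"
  shows "locally_conic_at (map_matrix P) X"
proof -
  have "\<forall>\<^sub>F Z in nhds X. \<forall>\<tau>\<in>{0..1}. P (X $ i $ j + \<tau> *\<^sub>R (Z $ i $ j - X $ i $ j))
      = P (X $ i $ j) + \<tau> *\<^sub>R (P (Z $ i $ j) - P (X $ i $ j))" for i j
    by (rule eventually_compose_filterlim[OF assms[of "X $ i $ j", unfolded locally_conic_at_def]])
      (intro tendsto_intros filterlim_ident)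
  then have "\<forall>\<^sub>F Z in nhds X. \<forall>i j. \<forall>\<tau>\<in>{0..1}. P (X $ i $ j + \<tau> *\<^sub>R (Z $ i $ j - X $ i $ j))
      = P (X $ i $ j) + \<tau> *\<^sub>R (P (Z $ i $ j) - P (X $ i $ j))"
    by (intro eventually_all_finite)
  then show ?thesis
    unfolding locally_conic_at_def by eventually_elim (auto simp: vec_eq_iff)
qed

definition columns_ge :: "(real \<Rightarrow> real) \<Rightarrow> real \<Rightarrow> (real^'p^'n) set" where
  "columns_ge P c = {X. \<forall>j. c \<le> norm (column j (map_matrix P X))}"

lemma columns_ge_nonzero:
  "c > 0 \<Longrightarrow> X \<in> columns_ge P c \<Longrightarrow> column j (map_matrix P X) \<noteq> 0"
  unfolding columns_ge_def using not_less norm_zero by (metis (mono_tags) mem_Collect_eq)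

text \<open>Semismoothness needs a full neighbourhood, which may leave the tube. A 1-Lipschitz
  \<open>P\<close> lowers column norms by at most the distance moved, so radius \<open>c / 2\<close>
  leaves a margin of \<open>c / 2\<close>.\<close>

lemma ball_subset_columns_ge:
  fixes P :: "real \<Rightarrow> real" and X :: "real^'p^'n"
  assumes "1-lipschitz_on UNIV P" "X \<in> columns_ge P c"
  shows "ball X (c / 2) \<subseteq> columns_ge P (c / 2)"
proof
  fix Z assume Z: "Z \<in> ball X (c / 2)"
  have "c / 2 \<le> norm (column j (map_matrix P Z))" for j
  proof -
    have "norm (column j (map_matrix P X)) - norm (column j (map_matrix P Z))
        \<le> norm (column j (map_matrix P X - map_matrix P Z))"
      by (simp add: column_simps norm_triangle_ineq2)
    also have "\<dots> \<le> norm (map_matrix P X - map_matrix P Z)" by (rule norm_column_le)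
    also have "\<dots> \<le> dist X Z"
      using lipschitz_onD[OF map_matrix_lipschitz[OF assms(1)], of X Z] by (simp add: dist_norm)
    moreover have "c \<le> norm (column j (map_matrix P X))"
      using assms(2) by (simp add: columns_ge_def)
    ultimately show ?thesis using Z by simp
  qed
  then show "Z \<in> columns_ge P (c / 2)" by (simp add: columns_ge_def)
qed

lemma normalize_map_lipschitz:
  fixes P :: "real \<Rightarrow> real"
  assumes "1-lipschitz_on UNIV P" "c > 0"
  shows "(2 / c)-lipschitz_on (columns_ge P c)
    (normalize_columns \<circ> map_matrix P :: real^'p^'n \<Rightarrow> real^'p^'n)"
proof -
  have "(2 / c * 1)-lipschitz_on (columns_ge P c)
    (normalize_columns \<circ> map_matrix P :: real^'p^'n \<Rightarrow> real^'p^'n)"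
    by (rule lipschitz_on_compose
        [OF lipschitz_on_subset[OF map_matrix_lipschitz[OF assms(1)] subset_UNIV]
          lipschitz_on_subset[OF normalize_columns_lipschitz[OF assms(2)]]])
      (auto simp: columns_ge_def)
  then show ?thesis by simp
qed

text \<open>The formula for \<open>A\<close> is assumed wherever no column vanishes, not only on a
  tube, so that it covers the ball around \<open>X\<close>.\<close>

lemma semismooth_at_normalize_map:
  fixes P :: "real \<Rightarrow> real" and X :: "real^'p^'n"
  assumes P: "1-lipschitz_on UNIV P" "\<And>x. locally_conic_at P x"
    and "c > 0" "X \<in> columns_ge P c"
    and A: "\<And>Z. (\<And>j. column j (map_matrix P Z) \<noteq> 0) \<Longrightarrow> A Z = {normalize_columns (map_matrix P Z)}"
  shows "semismooth_at A X"
proof -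
  obtain F' :: "real^'p^'n \<Rightarrow> (real^'p^'n) \<Rightarrow>\<^sub>L (real^'p^'n)" where F':
    "open {Y :: real^'p^'n. \<forall>j. column j Y \<noteq> 0}"
    "\<And>Y. Y \<in> {Y. \<forall>j. column j Y \<noteq> 0} \<Longrightarrow> (normalize_columns has_derivative blinfun_apply (F' Y)) (at Y)"
    "\<And>Y. Y \<in> {Y. \<forall>j. column j Y \<noteq> 0} \<Longrightarrow> isCont F' Y"
    using normalize_columns_C1 by blast
  have X: "map_matrix P X \<in> {Y. \<forall>j. column j Y \<noteq> 0}"
    using columns_ge_nonzero[OF assms(3,4)] by simp
  have sub: "ball X (c / 2) \<subseteq> columns_ge P (c / 2)"
    using P(1) assms(4) by (rule ball_subset_columns_ge)
  show ?thesis
  proof (rule semismooth_at_compose_conic[where F = normalize_columns and S = "map_matrix P"])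
    show "c / 2 > 0" using assms(3) by simp
    show "A Z = {normalize_columns (map_matrix P Z)}" if "Z \<in> ball X (c / 2)" for Z
      using that sub assms(3) columns_ge_nonzero[of "c / 2" Z P] by (intro A) auto
    show "(2 / (c / 2))-lipschitz_on (ball X (c / 2)) (normalize_columns \<circ> map_matrix P)"
      using sub assms(3) by (intro lipschitz_on_subset[OF normalize_map_lipschitz[OF P(1)]]) auto
    show "1-lipschitz_on UNIV (map_matrix P :: real^'p^'n \<Rightarrow> _)" using P(1) by (rule map_matrix_lipschitz)
    show "locally_conic_at (map_matrix P) X" using P(2) by (rule locally_conic_at_map_matrix)
  qed (use F' X in auto)
qed

section \<open>Soft thresholding and the positive part\<close>

text \<open>For \<tau> \<ge> 0 this is the soft-thresholding operator
  \<open>sgn x * max 0 (\<bar>x\<bar> - \<tau>)\<close>. As a difference of two positive parts it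
  inherits conicity from \<open>max 0\<close>.\<close>

definition soft :: "real \<Rightarrow> real \<Rightarrow> real" where
  "soft \<tau> x = max 0 (x - \<tau>) - max 0 (- x - \<tau>)"

lemma soft_lipschitz: "\<tau> \<ge> 0 \<Longrightarrow> 1-lipschitz_on UNIV (soft \<tau>)"
  by (intro lipschitz_onI) (auto simp: soft_def dist_real_def)

lemma abs_diff_soft_le: "\<tau> \<ge> 0 \<Longrightarrow> \<bar>x - soft \<tau> x\<bar> \<le> \<tau>"
  by (auto simp: soft_def)

lemma soft_0 [simp]: "soft 0 x = x"
  by (simp add: soft_def)

text \<open>The residual \<open>x - soft \<tau> x\<close> lies in \<open>{-\<tau>..\<tau>}\<close>,
  so its product with \<open>u\<close> is at most \<open>\<tau> * \<bar>u\<bar>\<close>.\<close>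

lemma soft_support:
  assumes "\<tau> \<ge> 0"
  shows "x * u - \<tau> * \<bar>u\<bar> \<le> soft \<tau> x * u"
proof -
  have "(x - soft \<tau> x) * u \<le> \<bar>x - soft \<tau> x\<bar> * \<bar>u\<bar>" by (metis abs_ge_self abs_mult)
  also have "\<dots> \<le> \<tau> * \<bar>u\<bar>" by (intro mult_right_mono abs_diff_soft_le assms) simp
  finally show ?thesis by (simp add: algebra_simps)
qed

text \<open>Contact occurs because the residual is \<tau> times the sign of
  \<open>soft \<tau> x\<close> when that is nonzero. The factor \<open>c\<close> stands for the
  inverse column norm brought in by normalisation.\<close>

lemma soft_support_eq:
  assumes "\<tau> \<ge> 0" "c \<ge> 0"
  shows "x * (c * soft \<tau> x) - \<tau> * \<bar>c * soft \<tau> x\<bar> = soft \<tau> x * (c * soft \<tau> x)"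
proof -
  have "x * soft \<tau> x - \<tau> * \<bar>soft \<tau> x\<bar> = soft \<tau> x * soft \<tau> x"
    using assms(1) by (auto simp: soft_def max_def algebra_simps abs_if)
  then have "c * (x * soft \<tau> x - \<tau> * \<bar>soft \<tau> x\<bar>) = c * (soft \<tau> x * soft \<tau> x)" by simp
  then show ?thesis using assms(2) by (simp add: abs_mult algebra_simps)
qed

text \<open>Away from 0 the sign is preserved along short segments, since half-lines are convex, and
  the map is linear there. At 0 it is positively homogeneous.\<close>

lemma locally_conic_at_max_0: "locally_conic_at (max (0::real)) x"
proof -
  consider "x > 0" | "x < 0" | "x = 0" by linarith
  then show ?thesis
  proof cases
    case 1
    then have "\<forall>\<^sub>F z in nhds x. z > 0" using eventually_nhds_in_open[of "{0<..}" x] by simp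
    then show ?thesis unfolding locally_conic_at_def
    proof eventually_elim
      case (elim z)
      have "0 \<le> x + \<tau> * (z - x)" if "\<tau> \<in> {0..1}" for \<tau>
        using convexD_alt[OF convex_real_interval(1)[of 0], of x z \<tau>] that elim 1
        by (simp add: algebra_simps)
      then show ?case using 1 elim by (intro ballI) (simp add: max.absorb2 less_imp_le)
    qed
  next
    case 2
    then have "\<forall>\<^sub>F z in nhds x. z < 0" using eventually_nhds_in_open[of "{..<0}" x] by simp
    then show ?thesis unfolding locally_conic_at_def
    proof eventually_elim
      case (elim z)
      have "x + \<tau> * (z - x) \<le> 0" if "\<tau> \<in> {0..1}" for \<tau>
        using convexD_alt[OF convex_real_interval(2)[of 0], of x z \<tau>] that elim 2
        by (simp add: algebra_simps)
      then show ?case using 2 elim by (intro ballI) (simp add: max.absorb1 less_imp_le)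
    qed
  next
    case 3
    then show ?thesis
      by (auto simp: locally_conic_at_def max_def mult_le_0_iff zero_le_mult_iff)
  qed
qed

lemma locally_conic_at_diff:
  assumes "locally_conic_at f x" "locally_conic_at g x"
  shows "locally_conic_at (\<lambda>x. f x - g x) x"
  using assms unfolding locally_conic_at_def
  by eventually_elim (auto simp: algebra_simps)

lemma locally_conic_at_compose_affine:
  fixes f :: "real \<Rightarrow> real"
  assumes "locally_conic_at f (a * x + b)"
  shows "locally_conic_at (\<lambda>x. f (a * x + b)) x"
proof -
  have "((\<lambda>z. a * z + b) \<longlongrightarrow> a * x + b) (nhds x)"
    by (intro tendsto_intros filterlim_ident)
  from eventually_compose_filterlim[OF assms[unfolded locally_conic_at_def] this]
  show ?thesis unfolding locally_conic_at_def
    by eventually_elim (auto simp: algebra_simps)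
qed

lemma locally_conic_at_soft: "locally_conic_at (soft \<tau>) x"
proof -
  have "locally_conic_at (\<lambda>x. max 0 (1 * x + - \<tau>) - max 0 ((-1) * x + - \<tau>)) x"
    by (intro locally_conic_at_diff locally_conic_at_compose_affine locally_conic_at_max_0)
  moreover have "soft \<tau> = (\<lambda>x. max 0 (1 * x + - \<tau>) - max 0 ((-1) * x + - \<tau>))"
    by (simp add: fun_eq_iff soft_def)
  ultimately show ?thesis by simp
qed

section \<open>Proximal maps: monotonicity and a closed form for domains inside
  \<open>Ob\<close>\<close>

lemma mem_prox_iff:
  "u \<in> prox h t x \<longleftrightarrow> (\<forall>v. ereal t * h u + ereal (1/2 * (norm (x - u))\<^sup>2)
      \<le> ereal t * h v + ereal (1/2 * (norm (x - v))\<^sup>2))"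
  by (simp add: prox_def is_arg_min_def not_less)

lemma prox_finite:
  assumes "proper_fun h" "t > 0" "u \<in> prox h t x"
  obtains a where "h u = ereal a"
proof -
  obtain v where v: "h v < \<infinity>" using assms(1) by (auto simp: proper_fun_def dom_fun_def)
  moreover have "h v \<noteq> -\<infinity>" "h u \<noteq> -\<infinity>" using assms(1) by (auto simp: proper_fun_def)
  ultimately obtain b where b: "h v = ereal b" by (cases "h v") auto
  have "h u \<noteq> \<infinity>"
    using assms(2,3) b unfolding mem_prox_iff by (auto dest!: spec[of _ v])
  then show ?thesis using that \<open>h u \<noteq> -\<infinity>\<close> by (cases "h u") auto
qed

text \<open>Each minimiser is tested against the other and the two inequalities are added. The
  values of \<open>h\<close> and the squared norms cancel, which leaves the inner product; convexity
  does not enter.\<close>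

lemma prox_monotone:
  fixes h :: "'a::real_inner \<Rightarrow> ereal"
  assumes h: "proper_fun h" "t > 0" and u: "u \<in> prox h t x" and v: "v \<in> prox h t y"
  shows "inner (u - v) (x - y) \<ge> 0"
proof -
  obtain a b where ab: "h u = ereal a" "h v = ereal b"
    using prox_finite[OF h u] prox_finite[OF h v] by metis
  have "t * a + 1/2 * (norm (x - u))\<^sup>2 \<le> t * b + 1/2 * (norm (x - v))\<^sup>2"
    using u[unfolded mem_prox_iff, rule_format, of v] ab by simp
  moreover have "t * b + 1/2 * (norm (y - v))\<^sup>2 \<le> t * a + 1/2 * (norm (y - u))\<^sup>2"
    using v[unfolded mem_prox_iff, rule_format, of u] ab by simp
  ultimately show ?thesis
    by (simp add: power2_norm_eq_inner inner_simps inner_commute algebra_simps)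
qed

text \<open>For unit vectors the inner product is 1 minus half the squared distance. The exact gap
  shows that \<open>sgn y\<close> is the only maximiser on the sphere when \<open>y\<close> is
  nonzero.\<close>

lemma inner_sgn_gap:
  fixes y u :: "'a::real_inner"
  assumes "norm u = 1"
  shows "inner y (sgn y) - inner y u = norm y * (norm (sgn y - u))\<^sup>2 / 2"
proof (cases "y = 0")
  case False
  then have s: "norm (sgn y) = 1" by (simp add: norm_sgn)
  have y: "inner y v = norm y * inner (sgn y) v" for v using False by (simp add: sgn_div_norm)
  have "inner (sgn y) (sgn y) = 1" using s by (simp add: norm_eq_1)
  moreover have "inner (sgn y) u = (2 - (norm (sgn y - u))\<^sup>2) / 2"
    using s assms by (simp add: dot_norm_neg)
  ultimately show ?thesis by (simp add: y diff_divide_distrib right_diff_distrib)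
qed simp

lemma inner_normalize_columns_less:
  fixes Y U :: "real^'p^'n"
  assumes "\<And>j. column j Y \<noteq> 0" "U \<in> Ob" "U \<noteq> normalize_columns Y"
  shows "inner Y U < inner Y (normalize_columns Y)"
proof -
  have U: "norm (column j U) = 1" for j using assms(2) by (simp add: Ob_iff)
  obtain j where j: "column j U \<noteq> sgn (column j Y)"
    using assms(3) by (auto simp: matrix_eq_iff_columns)
  have "0 < (\<Sum>j\<in>UNIV. norm (column j Y) * (norm (sgn (column j Y) - column j U))\<^sup>2 / 2)"
    using j assms(1) by (intro sum_pos2[where i = j]) auto
  also have "\<dots> = inner Y (normalize_columns Y) - inner Y U"
    by (simp add: inner_eq_sum_columns inner_sgn_gap[OF U] flip: sum_subtractf)
  finally show ?thesis by simp
qed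

text \<open>On \<^const>\<open>Ob\<close> the Frobenius norm is constant, so the proximal objective is
  \<open>t * h U - inner X U\<close> up to a constant; the hypotheses say that it is minorised by the linear
  function \<open>- inner Y U - k\<close>, with contact at the minimiser of the latter.\<close>

lemma prox_eq_normalize_columns:
  fixes X Y :: "real^'p^'n"
  assumes "t > 0" "proper_fun h" and Y: "\<And>j. column j Y \<noteq> 0"
    and dom: "dom_fun h \<subseteq> Ob"
    and le: "\<And>U a. h U = ereal a \<Longrightarrow> inner X U - t * a \<le> inner Y U + k"
    and a0: "h (normalize_columns Y) = ereal a0"
    and eq: "inner X (normalize_columns Y) - t * a0 = inner Y (normalize_columns Y) + k"
  shows "prox h t X = {normalize_columns Y}"
proof -
  let ?U = "normalize_columns Y"
  \<comment> \<open>The strict comparison yields minimality and uniqueness at once.\<close>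
  have *: "ereal t * h ?U + ereal (1/2 * (norm (X - ?U))\<^sup>2) < ereal t * h V + ereal (1/2 * (norm (X - V))\<^sup>2)"
    if V: "V \<noteq> ?U" for V
  proof (cases "h V = \<infinity>")
    case True
    then show ?thesis using a0 assms(1) by simp
  next
    case False
    moreover have "h V \<noteq> -\<infinity>" using assms(2) by (simp add: proper_fun_def)
    ultimately obtain b where b: "h V = ereal b" by (cases "h V") auto
    have VOb: "V \<in> Ob" "?U \<in> Ob"
      using b dom normalize_columns_in_Ob[OF Y] by (auto simp: dom_fun_def)
    then have "(norm V)\<^sup>2 = (norm ?U)\<^sup>2"
      by (simp add: norm_sq_eq_sum_columns Ob_iff)
    moreover have "inner Y V < inner Y ?U"
      using Y VOb(1) V by (rule inner_normalize_columns_less)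
    moreover note le[OF b] eq
    ultimately have "t * a0 + 1/2 * (norm (X - ?U))\<^sup>2 < t * b + 1/2 * (norm (X - V))\<^sup>2"
      by (simp add: power2_norm_eq_inner inner_simps inner_commute algebra_simps)
    then show ?thesis using a0 b by simp
  qed
  show ?thesis
  proof (intro equalityI subsetI)
    fix U assume "U \<in> prox h t X"
    then show "U \<in> {?U}" using *[of U] unfolding mem_prox_iff by (metis leD singletonI)
  next
    fix U assume "U \<in> {?U}"
    then show "U \<in> prox h t X" unfolding mem_prox_iff
      using * by (metis less_imp_le order_refl singletonD)
  qed
qed

text \<open>Shared by both functions: \<open>P t\<close> is the entrywise map and \<open>c\<close>
  keeps the mapped columns of tube points away from 0, which gives the Lipschitz constant
  \<open>2 / c\<close>.\<close>

lemma strongly_prox_regular_wrtI: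
  fixes h :: "real^'p^'n \<Rightarrow> ereal" and P :: "real \<Rightarrow> real \<Rightarrow> real"
  assumes h: "proper_fun h" "closed_fun h" "compact C" "dom_fun h \<subseteq> C" "norm_fun N" "\<gamma> > 0"
    and P: "\<And>t. 0 < t \<Longrightarrow> t \<le> \<gamma> \<Longrightarrow> 1-lipschitz_on UNIV (P t)" and "c > 0"
    and tube: "\<And>t. 0 < t \<Longrightarrow> t \<le> \<gamma> \<Longrightarrow> tube C N \<gamma> \<subseteq> columns_ge (P t) c"
    and prox: "\<And>t Z. 0 < t \<Longrightarrow> t \<le> \<gamma> \<Longrightarrow> (\<And>j. column j (map_matrix (P t) Z) \<noteq> 0) \<Longrightarrow>
      prox h t Z = {normalize_columns (map_matrix (P t) Z)}"
  shows "strongly_prox_regular_wrt h C N \<gamma>"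
proof -
  have "single_valued_on (tube C N \<gamma>) (prox h t) \<and>
        (\<exists>L. L-lipschitz_on (tube C N \<gamma>) (selection (prox h t))) \<and>
        monotone_map_on (tube C N \<gamma>) (selection (prox h t))" if "t \<in> {0<..\<gamma>}" for t
  proof -
    have t: "0 < t" "t \<le> \<gamma>" using that by auto
    have eq: "prox h t Z = {normalize_columns (map_matrix (P t) Z)}" if "Z \<in> tube C N \<gamma>" for Z
      using tube[OF t] that columns_ge_nonzero[OF \<open>c > 0\<close>] by (intro prox t) blast
    then have sel: "selection (prox h t) Z = normalize_columns (map_matrix (P t) Z)"
      if "Z \<in> tube C N \<gamma>" for Z
      using that by (simp add: selection_def)
    have "(2 / c)-lipschitz_on (tube C N \<gamma>) (normalize_columns \<circ> map_matrix (P t))"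
      by (rule lipschitz_on_subset[OF normalize_map_lipschitz[OF P[OF t] \<open>c > 0\<close>] tube[OF t]])
    then have "(2 / c)-lipschitz_on (tube C N \<gamma>) (selection (prox h t))"
      by (rule lipschitz_on_transform) (simp add: sel)
    moreover have "monotone_map_on (tube C N \<gamma>) (selection (prox h t))"
      unfolding monotone_map_on_def
      by (intro ballI prox_monotone[OF h(1) t(1)]) (simp_all add: eq sel)
    ultimately show ?thesis using eq by (auto simp: single_valued_on_def)
  qed
  then show ?thesis using h by (simp add: strongly_prox_regular_wrt_def)
qed

section \<open>Compactness, properness, closedness and the norms\<close>

lemma normalize_columns_nth:
  "normalize_columns Y $ i $ j = inverse (norm (column j Y)) * Y $ i $ j"
  by (simp add: normalize_columns_def sgn_div_norm column_def)

lemma inner_matrix: "inner X (Y :: real^'p^'n) = (\<Sum>i\<in>UNIV. \<Sum>j\<in>UNIV. X $ i $ j * Y $ i $ j)"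
  by (simp add: inner_vec_def)

lemma compact_Ob: "compact (Ob :: (real^'p^'n) set)"
proof -
  have "closed {X :: real^'p^'n. norm (column j X) = 1}" for j
    by (intro closed_Collect_eq continuous_intros
        bounded_linear.continuous_on[OF bounded_linear_column])
  then have "closed (\<Inter>j. {X :: real^'p^'n. norm (column j X) = 1})" by (intro closed_INT) auto
  also have "(\<Inter>j. {X :: real^'p^'n. norm (column j X) = 1}) = Ob"
    by (auto simp: Ob_iff)
  finally have "closed (Ob :: (real^'p^'n) set)" .
  moreover have "bounded (Ob :: (real^'p^'n) set)"
    unfolding bounded_iff
  proof (intro exI ballI)
    fix X :: "real^'p^'n" assume "X \<in> Ob"
    then have "(norm X)\<^sup>2 = real CARD('p)" by (simp add: norm_sq_eq_sum_columns Ob_iff)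
    then show "norm X \<le> sqrt (real CARD('p))" by (metis norm_ge_zero order_refl real_sqrt_unique)
  qed
  ultimately show ?thesis by (simp add: compact_eq_bounded_closed)
qed

lemma Ob_nonneg_subset_Ob: "Ob_nonneg \<subseteq> Ob"
  by (simp add: Ob_nonneg_def)

lemma compact_Ob_nonneg: "compact (Ob_nonneg :: (real^'p^'n) set)"
proof -
  have "{X :: real^'p^'n. \<forall>i j. X $ i $ j \<ge> 0} = (\<Inter>i. \<Inter>j. {X. X $ i $ j \<ge> 0})" by auto
  moreover have "closed {X :: real^'p^'n. X $ i $ j \<ge> 0}" for i j
    by (intro closed_Collect_le continuous_intros)
  ultimately have "closed {X :: real^'p^'n. \<forall>i j. X $ i $ j \<ge> 0}" by (simp add: closed_INT)
  then show ?thesis unfolding Ob_nonneg_def by (intro compact_Int_closed compact_Ob)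
qed

lemma Ob_nonneg_nonempty: "Ob_nonneg \<noteq> ({} :: (real^'p^'n) set)"
proof -
  have "column j (\<chi> i j. 1 :: real^'p^'n) \<noteq> 0" for j
    by (simp add: column_def vec_eq_iff)
  then have "normalize_columns (\<chi> i j. 1) \<in> (Ob_nonneg :: (real^'p^'n) set)"
    by (simp add: Ob_nonneg_def normalize_columns_in_Ob normalize_columns_nth)
  then show ?thesis by blast
qed

lemma dom_l1_ob_fun: "dom_fun (l1_ob_fun lam) = Ob"
  by (auto simp: dom_fun_def l1_ob_fun_def ind_fun_def)

lemma dom_ind_fun: "dom_fun (ind_fun S) = S"
  by (auto simp: dom_fun_def ind_fun_def)

lemma proper_l1_ob_fun: "proper_fun (l1_ob_fun lam :: real^'p^'n \<Rightarrow> ereal)"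
  using Ob_nonneg_nonempty
  by (auto simp: proper_fun_def dom_l1_ob_fun l1_ob_fun_def ind_fun_def Ob_nonneg_def)

lemma proper_ind_fun: "S \<noteq> {} \<Longrightarrow> proper_fun (ind_fun S)"
  by (simp add: proper_fun_def dom_ind_fun ind_fun_def)

lemma closed_l1_ob_fun: "closed_fun (l1_ob_fun lam :: real^'p^'n \<Rightarrow> ereal)"
proof -
  have "{(X, r). l1_ob_fun lam X \<le> ereal r}
      = (Ob \<times> UNIV) \<inter> {p :: (real^'p^'n) \<times> real. lam * l1_norm (fst p) \<le> snd p}"
    by (auto simp: l1_ob_fun_def ind_fun_def split: if_splits)
  moreover have "closed {p :: (real^'p^'n) \<times> real. lam * l1_norm (fst p) \<le> snd p}"
    unfolding l1_norm_def by (intro closed_Collect_le continuous_intros)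
  moreover have "closed ((Ob :: (real^'p^'n) set) \<times> (UNIV :: real set))"
    by (intro closed_Times compact_imp_closed[OF compact_Ob] closed_UNIV)
  ultimately show ?thesis unfolding closed_fun_def by (simp add: closed_Int)
qed

lemma closed_ind_fun:
  assumes "closed S"
  shows "closed_fun (ind_fun S)"
proof -
  have "{(x, r). ind_fun S x \<le> ereal r} = S \<times> {0..}"
    by (auto simp: ind_fun_def split: if_splits)
  then show ?thesis unfolding closed_fun_def using assms by (simp add: closed_Times)
qed

lemma norm_fun_norm: "norm_fun norm"
  by (simp add: norm_fun_def norm_triangle_ineq)

lemma norm_column_le_norm_2_inf: "norm (column j V) \<le> norm_2_inf V"
  unfolding norm_2_inf_def by (intro Max_ge) auto

lemma norm_2_inf_le: "(\<And>j. norm (column j V) \<le> b) \<Longrightarrow> norm_2_inf V \<le> b"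
  unfolding norm_2_inf_def by (subst Max_le_iff) auto

lemma norm_2_inf_attained:
  fixes V :: "real^'p^'n"
  obtains j where "norm_2_inf V = norm (column j V)"
proof -
  have "norm_2_inf V \<in> range (\<lambda>j. norm (column j V))"
    unfolding norm_2_inf_def by (intro Max_in) auto
  then show ?thesis using that by blast
qed

lemma norm_fun_norm_2_inf: "norm_fun (norm_2_inf :: real^'p^'n \<Rightarrow> real)"
  unfolding norm_fun_def
proof (intro conjI allI)
  fix V W :: "real^'p^'n" and a :: real
  show "norm_2_inf V = 0 \<longleftrightarrow> V = 0"
  proof
    assume "norm_2_inf V = 0"
    then have "column j V = 0" for j using norm_column_le_norm_2_inf[of j V] by simp
    then show "V = 0" by (simp add: column_def vec_eq_iff)
  next
    assume "V = 0"
    moreover obtain j where "norm_2_inf V = norm (column j V)" by (rule norm_2_inf_attained)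
    ultimately show "norm_2_inf V = 0" by (simp add: column_def vec_eq_iff)
  qed
  show "norm_2_inf (a *\<^sub>R V) = \<bar>a\<bar> * norm_2_inf V"
  proof (rule antisym)
    show "norm_2_inf (a *\<^sub>R V) \<le> \<bar>a\<bar> * norm_2_inf V"
      by (rule norm_2_inf_le) (simp add: column_simps mult_left_mono norm_column_le_norm_2_inf)
    obtain j where "norm_2_inf V = norm (column j V)" by (rule norm_2_inf_attained)
    then show "\<bar>a\<bar> * norm_2_inf V \<le> norm_2_inf (a *\<^sub>R V)"
      using norm_column_le_norm_2_inf[of j "a *\<^sub>R V"] by (simp add: column_simps)
  qed
  show "norm_2_inf (V + W) \<le> norm_2_inf V + norm_2_inf W"
    by (rule norm_2_inf_le)
      (auto simp: column_simps intro!: norm_triangle_le add_mono norm_column_le_norm_2_inf)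
qed

section \<open>Tubes and their base points\<close>

text \<open>Stated for any \<open>N\<close> that dominates the column norms, so that it serves both
  \<open>norm\<close> and \<open>norm_2_inf\<close>.\<close>

lemma tube_column_close:
  assumes "Z \<in> tube C N \<gamma>" "C \<subseteq> Ob" "\<And>j V. norm (column j V) \<le> N V"
  obtains X where "X \<in> C" "\<And>j. norm (column j (Z - X)) \<le> \<gamma>"
proof -
  obtain X s V where Z: "Z = X + s *\<^sub>R V" "X \<in> C" "N V = 1" "0 \<le> s" "s \<le> \<gamma>"
    using assms(1) by (auto simp: tube_def)
  have "norm (column j (Z - X)) \<le> \<gamma>" for j
  proof -
    have "norm (column j (Z - X)) = s * norm (column j V)" using Z by (simp add: column_simps)
    also have "\<dots> \<le> s * 1" using assms(3)[of j V] Z by (intro mult_left_mono) auto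
    finally show ?thesis using Z by simp
  qed
  then show ?thesis using that Z by blast
qed

text \<open>For a single row, \<open>l1_norm\<close> is constant on \<^const>\<open>Ob\<close>. Thresholding at \<open>t * lam\<close> would
  give \<open>0\<close> at some tube points for \<open>t = 1 / (lam + 1)\<close>, so no thresholding is used then.\<close>

definition threshold :: "'n itself \<Rightarrow> real \<Rightarrow> real \<Rightarrow> real" where
  "threshold _ lam t = (if CARD('n) = 1 then 0 else t * lam)"

section \<open>Closed forms of the two proximal maps\<close>

lemma l1_norm_single_row:
  fixes U :: "real^'p^'n"
  assumes "CARD('n) = 1" "U \<in> Ob"
  shows "l1_norm U = real CARD('p)"
proof -
  obtain i :: 'n where i: "UNIV = {i}" using assms(1) by (metis card_1_singletonE)
  have "\<bar>U $ i $ j\<bar> = 1" for j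
  proof -
    have "norm (column j U) = \<bar>U $ i $ j\<bar>" by (simp add: norm_vec_def L2_set_def i column_def)
    then show ?thesis using assms(2) by (simp add: Ob_iff)
  qed
  then show ?thesis by (simp add: l1_norm_def i)
qed

text \<open>With one row, \<open>Y = X\<close> and the constant l1 term goes into \<open>k\<close>.
  Otherwise \<open>k = 0\<close>, and the bound and the contact hold entry by entry by
  \<open>soft_support\<close> and \<open>soft_support_eq\<close>.\<close>

lemma prox_l1_ob_fun:
  fixes X :: "real^'p^'n" and lam t :: real
  defines "Y \<equiv> map_matrix (soft (threshold TYPE('n) lam t)) X"
  assumes "lam > 0" "t > 0" and Y: "\<And>j. column j Y \<noteq> 0"
  shows "prox (l1_ob_fun lam) t X = {normalize_columns Y}"
proof (rule prox_eq_normalize_columns[where k = "if CARD('n) = 1 then - t * lam * CARD('p) else 0"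
      and ?a0.0 = "lam * l1_norm (normalize_columns Y)"])
  have OU: "normalize_columns Y \<in> Ob" using Y by (rule normalize_columns_in_Ob)
  show "l1_ob_fun lam (normalize_columns Y) = ereal (lam * l1_norm (normalize_columns Y))"
    using OU by (simp add: l1_ob_fun_def ind_fun_def)
  have \<tau>: "t * lam \<ge> 0" using assms by simp
  have Y1: "Y = X" if "CARD('n) = 1"
    using that by (simp add: Y_def threshold_def vec_eq_iff)
  have obj: "inner X U - t * (lam * l1_norm U)
      = (\<Sum>i\<in>UNIV. \<Sum>j\<in>UNIV. X $ i $ j * U $ i $ j - t * lam * \<bar>U $ i $ j\<bar>)" for U :: "real^'p^'n"
    by (simp add: inner_matrix l1_norm_def sum_subtractf sum_distrib_left mult.assoc)
  show "inner X U - t * a \<le> inner Y U + (if CARD('n) = 1 then - t * lam * CARD('p) else 0)"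
    if "l1_ob_fun lam U = ereal a" for U a
  proof -
    have U: "U \<in> Ob" "a = lam * l1_norm U"
      using that by (auto simp: l1_ob_fun_def ind_fun_def split: if_splits)
    show ?thesis
    proof (cases "CARD('n) = 1")
      case True
      then show ?thesis using Y1 U l1_norm_single_row[of U] by simp
    next
      case False
      have "inner X U - t * a \<le> inner Y U"
        unfolding U(2) obj unfolding inner_matrix
        by (intro sum_mono) (simp only: Y_def nth_map_matrix threshold_def False if_False soft_support[OF \<tau>])
      then show ?thesis using False by simp
    qed
  qed
  show "inner X (normalize_columns Y) - t * (lam * l1_norm (normalize_columns Y))
      = inner Y (normalize_columns Y) + (if CARD('n) = 1 then - t * lam * CARD('p) else 0)"
  proof (cases "CARD('n) = 1")
    case True
    then show ?thesis using Y1 OU l1_norm_single_row[of "normalize_columns Y"] by simp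
  next
    case False
    have "inner X (normalize_columns Y) - t * (lam * l1_norm (normalize_columns Y))
        = inner Y (normalize_columns Y)"
      unfolding obj unfolding inner_matrix normalize_columns_nth
      by (intro sum.cong refl)
        (simp only: Y_def nth_map_matrix threshold_def False if_False
          soft_support_eq[OF \<tau>] inverse_nonnegative_iff_nonnegative norm_ge_zero)
    then show ?thesis using False by simp
  qed
qed (use assms in \<open>simp_all add: proper_l1_ob_fun dom_l1_ob_fun\<close>)

lemma prox_ind_Ob_nonneg:
  fixes X :: "real^'p^'n"
  defines "Y \<equiv> map_matrix (max 0) X"
  assumes "t > 0" and Y: "\<And>j. column j Y \<noteq> 0"
  shows "prox (ind_fun Ob_nonneg) t X = {normalize_columns Y}"
proof (rule prox_eq_normalize_columns[where k = 0 and ?a0.0 = 0])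
  have "normalize_columns Y \<in> Ob_nonneg"
    using normalize_columns_in_Ob[OF Y] by (simp add: Ob_nonneg_def normalize_columns_nth Y_def)
  then show "ind_fun Ob_nonneg (normalize_columns Y) = ereal 0" by (simp add: ind_fun_def)
  show "inner X U - t * a \<le> inner Y U + 0" if "ind_fun Ob_nonneg U = ereal a" for U a
  proof -
    have U: "\<And>i j. 0 \<le> U $ i $ j" "a = 0"
      using that by (auto simp: ind_fun_def Ob_nonneg_def zero_ereal_def split: if_splits)
    have "inner X U \<le> inner Y U"
      unfolding inner_matrix by (intro sum_mono) (simp add: Y_def U mult_right_mono)
    then show ?thesis using U by simp
  qed
  \<comment> \<open>Contact: the minorant is exact at nonnegative multiples of the positive part,
    since both sides vanish where \<open>x\<close> is negative.\<close>
  have max_eq: "x * (c * max 0 x) = max 0 x * (c * max 0 x)" for x c :: real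
    by (simp add: max_def)
  show "inner X (normalize_columns Y) - t * 0 = inner Y (normalize_columns Y) + 0"
    unfolding inner_matrix normalize_columns_nth Y_def nth_map_matrix max_eq by simp
qed (use assms Ob_nonneg_subset_Ob in \<open>simp_all add: proper_ind_fun Ob_nonneg_nonempty dom_ind_fun\<close>)

section \<open>Lower bounds for the mapped columns on the tubes\<close>

text \<open>A unit column moved by at most \<gamma> keeps length \<open>1 - \<gamma>\<close>.
  Thresholding then changes each of its \<open>CARD('n)\<close> entries by at most \<tau>, and the
  Euclidean change is bounded by the sum of the entry changes.\<close>

lemma tube_subset_columns_ge_soft:
  assumes "\<tau> \<ge> 0"
  shows "tube (Ob :: (real^'p^'n) set) norm_2_inf \<gamma>
    \<subseteq> columns_ge (soft \<tau>) (1 - \<gamma> - real CARD('n) * \<tau>)"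
proof
  fix Z :: "real^'p^'n" assume "Z \<in> tube Ob norm_2_inf \<gamma>"
  then obtain X :: "real^'p^'n" where X: "X \<in> Ob" "\<And>j. norm (column j (Z - X)) \<le> \<gamma>"
    by (rule tube_column_close) (auto simp: norm_column_le_norm_2_inf)
  have "1 - \<gamma> - real CARD('n) * \<tau> \<le> norm (column j (map_matrix (soft \<tau>) Z))" for j
  proof -
    let ?z = "column j Z" and ?y = "column j (map_matrix (soft \<tau>) Z)"
    have "1 \<le> norm ?z + \<gamma>"
      using X norm_triangle_ineq2[of "column j X" "?z"]
      by (simp add: Ob_iff column_simps norm_minus_commute) (smt (verit))
    moreover have "norm (?z - ?y) \<le> real CARD('n) * \<tau>"
    proof -
      have "norm (?z - ?y) \<le> (\<Sum>i\<in>UNIV. \<bar>(?z - ?y) $ i\<bar>)" by (rule norm_le_l1_cart)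
      also have "\<dots> \<le> (\<Sum>i\<in>(UNIV :: 'n set). \<tau>)"
        by (intro sum_mono) (simp add: column_def abs_diff_soft_le assms)
      finally show ?thesis by simp
    qed
    ultimately show ?thesis using norm_triangle_ineq2[of ?z ?y] by simp
  qed
  then show "Z \<in> columns_ge (soft \<tau>) (1 - \<gamma> - real CARD('n) * \<tau>)" by (simp add: columns_ge_def)
qed

text \<open>The positive part fixes the nonnegative base matrix and is 1-Lipschitz in each entry, so
  clipping does not increase the distance to the base column.\<close>

lemma tube_subset_columns_ge_max:
  assumes N: "\<And>j V. norm (column j V) \<le> N V"
  shows "tube (Ob_nonneg :: (real^'p^'n) set) N \<gamma> \<subseteq> columns_ge (max 0) (1 - \<gamma>)"
proof
  fix Z :: "real^'p^'n" assume "Z \<in> tube Ob_nonneg N \<gamma>"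
  then obtain X :: "real^'p^'n" where X: "X \<in> Ob_nonneg" "\<And>j. norm (column j (Z - X)) \<le> \<gamma>"
    by (rule tube_column_close) (auto simp: Ob_nonneg_def N)
  have "1 - \<gamma> \<le> norm (column j (map_matrix (max 0) Z))" for j
  proof -
    let ?y = "column j (map_matrix (max 0) Z)"
    have "norm (column j X - ?y) \<le> norm (column j (Z - X))"
    proof (rule norm_le_componentwise_cart)
      fix i
      have "X $ i $ j \<ge> 0" using X(1) by (simp add: Ob_nonneg_def)
      then show "norm ((column j X - ?y) $ i) \<le> norm (column j (Z - X) $ i)"
        by (simp add: column_def)
    qed
    also have "\<dots> \<le> \<gamma>" by (rule X(2))
    finally show ?thesis
      using X(1) norm_triangle_ineq2[of "column j X" ?y] by (simp add: Ob_nonneg_def Ob_iff)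
  qed
  then show "Z \<in> columns_ge (max 0) (1 - \<gamma>)" by (simp add: columns_ge_def)
qed

section \<open>The two functions on their tubes\<close>

lemma l1_ob_fun_prox_regular_semismooth:
  fixes lam :: real
  assumes "lam > 0"
  defines "\<gamma> \<equiv> 1 / ((lam + 1) * real CARD('n))"
  shows "strongly_prox_regular_wrt (l1_ob_fun lam :: real^'p^'n \<Rightarrow> ereal) Ob norm_2_inf \<gamma>"
    and "\<And>t. 0 < t \<Longrightarrow> t \<le> \<gamma> \<Longrightarrow>
      semismooth_over (prox (l1_ob_fun lam :: real^'p^'n \<Rightarrow> ereal) t) (tube Ob norm_2_inf \<gamma>)"
proof -
  let ?\<tau> = "threshold TYPE('n) lam"
  \<comment> \<open>The worst case is t = \<gamma>, because the threshold is nondecreasing in t.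
    With one row \<open>c\<close> is \<open>lam / (lam + 1)\<close>; with n \<ge> 2 rows it is
    \<open>(n - 1) / ((lam + 1) * n)\<close>, an expression that would vanish at n = 1.\<close>
  define c where "c = 1 - \<gamma> - real CARD('n) * ?\<tau> \<gamma>"
  have "\<gamma> > 0" using assms by (simp add: \<gamma>_def)
  have "c > 0"
  proof (cases "CARD('n) = 1")
    case True
    then show ?thesis using assms by (simp add: c_def \<gamma>_def threshold_def)
  next
    case False
    then have "real CARD('n) \<ge> 2"
      using zero_less_card_finite[where 'a = 'n] by linarith
    moreover have "c = (real CARD('n) - 1) / ((lam + 1) * real CARD('n))"
    proof -
      have "(lam + 1) * real CARD('n) \<noteq> 0" using assms(1) by simp
      then have "1 - 1 / ((lam + 1) * real CARD('n)) - real CARD('n) * (1 / ((lam + 1) * real CARD('n)) * lam)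
          = ((lam + 1) * real CARD('n) - 1 - real CARD('n) * lam) / ((lam + 1) * real CARD('n))"
        by (simp add: diff_divide_distrib)
      then show ?thesis using False by (simp add: c_def \<gamma>_def threshold_def algebra_simps)
    qed
    ultimately show ?thesis using assms(1) by simp
  qed
  have \<tau>: "?\<tau> t \<ge> 0" "?\<tau> t \<le> ?\<tau> \<gamma>" if "0 < t" "t \<le> \<gamma>" for t
    using that assms(1) by (simp_all add: threshold_def)
  have tube: "tube (Ob :: (real^'p^'n) set) norm_2_inf \<gamma> \<subseteq> columns_ge (soft (?\<tau> t)) c"
    if "0 < t" "t \<le> \<gamma>" for t
  proof -
    have "c \<le> 1 - \<gamma> - real CARD('n) * ?\<tau> t"
      unfolding c_def using \<tau>(2)[OF that] by (simp add: mult_left_mono)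
    then have "columns_ge (soft (?\<tau> t)) (1 - \<gamma> - real CARD('n) * ?\<tau> t)
        \<subseteq> (columns_ge (soft (?\<tau> t)) c :: (real^'p^'n) set)"
      unfolding columns_ge_def by (blast intro: order_trans)
    then show ?thesis using tube_subset_columns_ge_soft[OF \<tau>(1)[OF that]] by blast
  qed
  show "strongly_prox_regular_wrt (l1_ob_fun lam :: real^'p^'n \<Rightarrow> ereal) Ob norm_2_inf \<gamma>"
  proof (rule strongly_prox_regular_wrtI[where P = "\<lambda>t. soft (?\<tau> t)" and c = c])
    show "1-lipschitz_on UNIV (soft (?\<tau> t))" if "0 < t" "t \<le> \<gamma>" for t
      using \<tau>(1)[OF that] by (rule soft_lipschitz)
  qed (use assms(1) \<open>\<gamma> > 0\<close> \<open>c > 0\<close> tube in \<open>simp_all add: proper_l1_ob_fun closed_l1_ob_fun compact_Ob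
      dom_l1_ob_fun norm_fun_norm_2_inf prox_l1_ob_fun\<close>)
  fix t assume t: "0 < t" "t \<le> \<gamma>"
  show "semismooth_over (prox (l1_ob_fun lam :: real^'p^'n \<Rightarrow> ereal) t) (tube Ob norm_2_inf \<gamma>)"
    unfolding semismooth_over_def
  proof
    fix X :: "real^'p^'n" assume "X \<in> tube Ob norm_2_inf \<gamma>"
    then show "semismooth_at (prox (l1_ob_fun lam) t) X"
      using tube[OF t] prox_l1_ob_fun[OF assms(1) t(1)]
      by (intro semismooth_at_normalize_map[OF soft_lipschitz[OF \<tau>(1)[OF t]] locally_conic_at_soft \<open>c > 0\<close>])
        auto
  qed
qed

text \<open>The two claims use tubes for different norms. Both norms dominate the column norms, so
  the same inclusion with \<open>c = 1 - \<gamma>\<close> applies. The positive part is independent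
  of t, so semismoothness holds for every t > 0.\<close>

lemma ind_Ob_nonneg_prox_regular_semismooth:
  assumes "0 < \<gamma>" "\<gamma> < 1"
  shows "strongly_prox_regular_wrt (ind_fun (Ob_nonneg :: (real^'p^'n) set)) Ob_nonneg norm \<gamma>"
    and "\<And>t. 0 < t \<Longrightarrow>
      semismooth_over (prox (ind_fun (Ob_nonneg :: (real^'p^'n) set)) t) (tube Ob_nonneg norm_2_inf \<gamma>)"
proof -
  have lip: "1-lipschitz_on UNIV (max (0 :: real))"
    by (intro lipschitz_onI) (auto simp: dist_real_def)
  have c: "1 - \<gamma> > 0" using assms by simp
  show "strongly_prox_regular_wrt (ind_fun (Ob_nonneg :: (real^'p^'n) set)) Ob_nonneg norm \<gamma>"
    by (rule strongly_prox_regular_wrtI[where P = "\<lambda>_. max 0" and c = "1 - \<gamma>"])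
      (use assms c tube_subset_columns_ge_max[of norm] in
        \<open>simp_all add: proper_ind_fun Ob_nonneg_nonempty closed_ind_fun compact_imp_closed
          compact_Ob_nonneg dom_ind_fun norm_fun_norm prox_ind_Ob_nonneg lip norm_column_le\<close>)
  fix t :: real assume t: "0 < t"
  show "semismooth_over (prox (ind_fun (Ob_nonneg :: (real^'p^'n) set)) t) (tube Ob_nonneg norm_2_inf \<gamma>)"
    unfolding semismooth_over_def
  proof
    fix X :: "real^'p^'n" assume "X \<in> tube Ob_nonneg norm_2_inf \<gamma>"
    then show "semismooth_at (prox (ind_fun Ob_nonneg) t) X"
      using tube_subset_columns_ge_max[OF norm_column_le_norm_2_inf] prox_ind_Ob_nonneg[OF t]
      by (intro semismooth_at_normalize_map[OF lip locally_conic_at_max_0 c]) auto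
  qed
qed


theorem lemma3p1:
  fixes lam :: real
  assumes "lam > 0"
  shows
    "strongly_prox_regular (l1_ob_fun lam :: real^'p^'n \<Rightarrow> ereal)
     \<and> strongly_prox_regular (ind_fun (Ob_nonneg :: (real^'p^'n) set))
     \<and> (let C1 = (Ob :: (real^'p^'n) set);
            \<gamma>1 = 1 / ((lam + 1) * real CARD('n))
        in strongly_prox_regular_wrt (l1_ob_fun lam) C1 norm_2_inf \<gamma>1
         \<and> (\<forall>t\<in>{0<..\<gamma>1}. semismooth_over (prox (l1_ob_fun lam) t) (tube C1 norm_2_inf \<gamma>1)))
     \<and> (\<forall>\<gamma>2. 0 < \<gamma>2 \<and> \<gamma>2 < 1 \<longrightarrow>
          (let C2 = (Ob_nonneg :: (real^'p^'n) set)
           in strongly_prox_regular_wrt (ind_fun Ob_nonneg) C2 norm \<gamma>2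
            \<and> (\<forall>t\<in>{0<..\<gamma>2}. semismooth_over (prox (ind_fun Ob_nonneg) t)
                             (tube C2 norm_2_inf \<gamma>2))))"
proof (intro conjI)
  show "strongly_prox_regular (l1_ob_fun lam :: real^'p^'n \<Rightarrow> ereal)"
    unfolding strongly_prox_regular_def using l1_ob_fun_prox_regular_semismooth(1)[OF assms] by blast
  show "strongly_prox_regular (ind_fun (Ob_nonneg :: (real^'p^'n) set))"
    unfolding strongly_prox_regular_def using ind_Ob_nonneg_prox_regular_semismooth(1)[of "1/2"] by fastforce
  show "let C1 = (Ob :: (real^'p^'n) set);
            \<gamma>1 = 1 / ((lam + 1) * real CARD('n))
        in strongly_prox_regular_wrt (l1_ob_fun lam) C1 norm_2_inf \<gamma>1
         \<and> (\<forall>t\<in>{0<..\<gamma>1}. semismooth_over (prox (l1_ob_fun lam) t) (tube C1 norm_2_inf \<gamma>1))"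
    unfolding Let_def by (intro conjI ballI l1_ob_fun_prox_regular_semismooth[OF assms]) simp_all
  show "\<forall>\<gamma>2. 0 < \<gamma>2 \<and> \<gamma>2 < 1 \<longrightarrow>
          (let C2 = (Ob_nonneg :: (real^'p^'n) set)
           in strongly_prox_regular_wrt (ind_fun Ob_nonneg) C2 norm \<gamma>2
            \<and> (\<forall>t\<in>{0<..\<gamma>2}. semismooth_over (prox (ind_fun Ob_nonneg) t)
                             (tube C2 norm_2_inf \<gamma>2)))"
    unfolding Let_def by (intro allI impI conjI ballI ind_Ob_nonneg_prox_regular_semismooth) simp_all
qed

end
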